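(* For all integers $n,r\ge0$ and real $x\ge 0$, $$\sum_{k=0}^{n}\binom{n}{k}(-1)^k\frac{1}{(k+x+1)^{r+2}}=\frac{(-1)^r}{(r+1)!}\sum_{l=0}^{r}\binom{r}{l}l!(-1)^lH_n(x,l+1)\int_0^1(1-t)^n(\log t)^{r-l}t^x\,dt,$$ $$\frac{(-1)^r}{(r+1)!}\sum_{n=0}^{\infty}\sum_{k=0}^{n}\binom{n}{k}(-1)^k\sum_{l=0}^{r}\binom{r}{l}l!(-1)^lH_k(x,l+1)\int_0^1(1-t)^k(\log t)^{r-l}t^x\,dt=\zeta(x+1,r+2),$$ and $$\sum_{l=0}^{r}\binom{r}{l}l!(-1)^l\sum_{n=1}^{\infty}\frac{1}{n}H_{n+1}^{(l+1)}\int_0^1(1-t)^n(\log t)^{r-l}\,dt=(-1)^r(r+2)!.$$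
   Context: For a positive integer $\alpha$, an integer $n\ge0$ and real $x\ge 0$, $H_n(x,\alpha)=\sum_{k=0}^{n}\frac{1}{(k+x+1)^{\alpha}}$. For positive integers $\alpha$, $H_m^{(\alpha)}=\sum_{j=1}^{m}\frac{1}{j^\alpha}$. $\zeta(y,s)=\sum_{n=0}^{\infty}\frac{1}{(n+y)^s}$ is the Hurwitz zeta function ($y>0$, $\mathrm{Re}(s)>1$). *)

theory Defs
  imports "HOL-Analysis.Analysis"
begin

definition shifted_harm :: "nat \<Rightarrow> real \<Rightarrow> nat \<Rightarrow> real" where
  "shifted_harm n x \<alpha> = (\<Sum>k=0..n. 1 / (real k + x + 1) ^ \<alpha>)"

definition gen_harm :: "nat \<Rightarrow> nat \<Rightarrow> real" where
  "gen_harm m \<alpha> = (\<Sum>j=1..m. 1 / real j ^ \<alpha>)"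

text \<open>The argument order is \<open>\<zeta>(y, s)\<close>, with the shift \<open>y\<close> first.
  The series is meaningful for \<open>y > 0\<close> and \<open>Re s > 1\<close>.\<close>

definition hurwitz_zeta :: "real \<Rightarrow> complex \<Rightarrow> complex" where
  "hurwitz_zeta y s = (\<Sum>n. 1 / complex_of_real (real n + y) powr s)"

text \<open>The integrals \<open>\<integral>\<^sub>0\<^sup>1 (1 - t)\<^sup>n (log t)\<^sup>m t\<^sup>x dt\<close> exist, so that the total operator
  \<^const>\<open>integral\<close> returns their actual value. The library's conventions \<open>ln 0 = 0\<close> and
  \<open>0 powr x = 0\<close> only affect the single point \<open>t = 0\<close>.\<close>

lemma log_beta_integrable:
  fixes x :: real and n m :: nat
  assumes "x \<ge> 0"
  shows "(\<lambda>t. (1 - t) ^ n * ln t ^ m * t powr x) integrable_on {0..1}"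
proof -
  define e :: real where "e = 1 / (2 * real m + 2)"
  have e: "e > 0" "e * real m \<le> 1 / 2" by (auto simp: e_def field_simps)
  have bound: "norm ((1 - t) ^ n * ln t ^ m * t powr x) \<le> (1 / e) ^ m * t powr (- (1 / 2))"
    if t: "t \<in> {0..1}" for t :: real
  proof (cases "t = 0")
    case True
    then show ?thesis by simp
  next
    case False
    with t have t': "0 < t" "t \<le> 1" by auto
    have "- e * ln t = ln (t powr (- e))" using t' by (simp add: ln_powr)
    also have "\<dots> \<le> t powr (- e)" using t' ln_bound[of "t powr (- e)"] by simp
    finally have "\<bar>ln t\<bar> \<le> 1 / e * t powr (- e)"
      using t' e by (simp add: field_simps)
    then have "\<bar>ln t\<bar> ^ m \<le> (1 / e * t powr (- e)) ^ m" by (intro power_mono) auto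
    also have "\<dots> = (1 / e) ^ m * t powr (- (e * real m))"
      using t' by (simp only: power_mult_distrib powr_power) (simp add: powr_power algebra_simps)
    also have "\<dots> \<le> (1 / e) ^ m * t powr (- (1 / 2))"
      using t' e by (intro mult_left_mono powr_mono') auto
    finally have l: "\<bar>ln t\<bar> ^ m \<le> (1 / e) ^ m * t powr (- (1 / 2))" .
    have "\<bar>(1 - t) ^ n\<bar> \<le> 1" using t' by (simp add: power_le_one)
    moreover have "t powr x \<le> 1" using t' assms by (simp add: powr_le1)
    ultimately have "\<bar>(1 - t) ^ n\<bar> * \<bar>ln t\<bar> ^ m * t powr x \<le> 1 * \<bar>ln t\<bar> ^ m * 1"
      by (intro mult_mono) auto
    with l show ?thesis by (simp add: abs_mult power_abs)
  qed
  show ?thesis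
  proof (rule measurable_bounded_by_integrable_imp_integrable[OF _ _ bound])
    have "(\<lambda>t::real. (1 - t) ^ n * ln t ^ m * t powr x) \<in> borel_measurable borel"
      by measurable
    then show "(\<lambda>t::real. (1 - t) ^ n * ln t ^ m * t powr x) \<in> borel_measurable (lebesgue_on {0..1})"
      by (simp add: borel_measurable_if_I measurable_completion measurable_restrict_space1)
    show "(\<lambda>t::real. (1 / e) ^ m * t powr (- (1 / 2))) integrable_on {0..1}"
      by (intro integrable_on_mult_right integrable_on_powr_from_0) auto
  qed auto
qed

end

theory Submission imports Defs "HOL-Real_Asymp.Real_Asymp" begin

text \<open>
  Let \<open>S\<^sub>a(n) = \<Sum>\<^sub>k (n choose k) (- 1)\<^sup>k / (k + x + 1)\<^sup>a\<close>. Expanding \<open>(1 - t)\<^sup>n\<close> shows that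
  \<open>\<integral>\<^sub>0\<^sup>1 (1 - t)\<^sup>n (ln t)\<^sup>m t\<^sup>x dt = (- 1)\<^sup>m m! S\<^sub>m\<^sub>+\<^sub>1(n)\<close>. Up to a factor independent of \<open>m\<close>,
  \<open>S\<^sub>m\<^sub>+\<^sub>1(n)\<close> is the complete homogeneous symmetric polynomial of degree \<open>m\<close> in the numbers
  \<open>1 / (k + x + 1)\<close>, \<open>k \<le> n\<close>, whose power sums are the shifted harmonic numbers; the first identity
  is therefore Newton's identity between complete homogeneous polynomials and power sums. Binomial
  inversion of the first identity gives the second one. The third one is the first one at \<open>x = 0\<close>,
  divided by \<open>n\<close> and summed, because \<open>\<Sum>\<^sub>n\<^sub>\<ge>\<^sub>1 S\<^sub>a(n) / n = a\<close> by telescoping.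
\<close>


section \<open>Integrals of powers times powers of the logarithm\<close>

lemma powr_mult_ln_power_tendsto_0:
  fixes a :: real assumes "a > 0"
  shows "((\<lambda>t. t powr a * ln t ^ m) \<longlongrightarrow> 0) (at_right 0)"
  using assms by real_asymp

text \<open>Integration by parts: the derivative of \<open>t powr (y + 1) * ln t ^ Suc m\<close>
  combines the integrands for \<open>Suc m\<close> and \<open>m\<close>, which gives the induction
  step.\<close>

lemma has_integral_powr_mult_ln_power:
  fixes y :: real
  assumes "y \<ge> 0"
  shows "((\<lambda>t. t powr y * ln t ^ m) has_integral (- 1) ^ m * fact m / (y + 1) ^ (m + 1)) {0..1}"
proof (induction m)
  case 0
  show ?case
    using has_integral_powr_from_0[of y 1] assms by simp
next
  case (Suc m)
  define F where "F = (\<lambda>t::real. t powr (y + 1) * ln t ^ Suc m)"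
  have cont: "continuous_on {0..1} F"
    unfolding continuous_on_def
  proof
    fix t :: real assume t: "t \<in> {0..1}"
    show "(F \<longlongrightarrow> F t) (at t within {0..1})"
    proof (cases "t = 0")
      case True
      have "(F \<longlongrightarrow> 0) (at_right 0)"
        unfolding F_def using assms by (intro powr_mult_ln_power_tendsto_0) auto
      then show ?thesis
        using True at_within_Icc_at_right[of 0 "1::real"] by (simp add: F_def)
    next
      case False
      with t have "isCont F t" unfolding F_def by (intro continuous_intros) auto
      then show ?thesis by (auto simp: isCont_def intro: tendsto_within_subset)
    qed
  qed
  have deriv: "(F has_vector_derivative
      ((y + 1) * (t powr y * ln t ^ Suc m) + real (Suc m) * (t powr y * ln t ^ m))) (at t)"
    if "t \<in> {0<..<1}" for t
  proof -
    have "(F has_real_derivative ((y + 1) * t powr (y + 1 - 1)) * ln t ^ Suc m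
        + ((1 + real m) * (1 / t * ln t ^ m)) * t powr (y + 1)) (at t)"
      unfolding F_def using that
      by (intro DERIV_mult has_real_derivative_powr DERIV_power_Suc DERIV_ln_divide) auto
    also have "((y + 1) * t powr (y + 1 - 1)) * ln t ^ Suc m
        + ((1 + real m) * (1 / t * ln t ^ m)) * t powr (y + 1) =
        (y + 1) * (t powr y * ln t ^ Suc m) + real (Suc m) * (t powr y * ln t ^ m)"
      using that by (simp add: powr_add)
    finally show ?thesis
      by (simp only: has_real_derivative_iff_has_vector_derivative)
  qed
  \<comment> \<open>There is no boundary term: \<open>F 1 = 0\<close> because of the logarithm, and
    \<open>F 0 = 0\<close> because \<open>0 powr (y + 1) = 0\<close>.\<close>
  have "((\<lambda>t. (y + 1) * (t powr y * ln t ^ Suc m) + real (Suc m) * (t powr y * ln t ^ m))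
      has_integral 0) {0..1}"
    using fundamental_theorem_of_calculus_interior[OF _ cont deriv] by (simp add: F_def)
  from has_integral_diff[OF this has_integral_mult_right[OF Suc.IH, of "real (Suc m)"]]
  have "((\<lambda>t. (y + 1) * (t powr y * ln t ^ Suc m)) has_integral
      - (real (Suc m) * ((- 1) ^ m * fact m / (y + 1) ^ (m + 1)))) {0..1}"
    by simp
  from has_integral_mult_right[OF this, of "inverse (y + 1)"]
  have "((\<lambda>t. inverse (y + 1) * ((y + 1) * (t powr y * ln t ^ Suc m))) has_integral
      inverse (y + 1) * - (real (Suc m) * ((- 1) ^ m * fact m / (y + 1) ^ (m + 1)))) {0..1}" .
  moreover have "inverse (y + 1) * ((y + 1) * z) = z" for z
    using assms by simp
  moreover have "inverse (y + 1) * - (real (Suc m) * ((- 1) ^ m * fact m / (y + 1) ^ (m + 1))) =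
      (- 1) ^ Suc m * fact (Suc m) / (y + 1) ^ (Suc m + 1)"
    by (simp add: divide_inverse mult_ac)
  ultimately show ?case by (simp only:)
qed

section \<open>Alternating binomial sums and their inversion\<close>

definition alt_binomial_sum :: "nat \<Rightarrow> (nat \<Rightarrow> real) \<Rightarrow> real" where
  "alt_binomial_sum n u = (\<Sum>k=0..n. real (n choose k) * (- 1) ^ k * u k)"

text \<open>Pascal's rule. Hence \<open>alt_binomial_sum n u\<close> is the value at 0 of the n-fold
  difference of \<open>u\<close>, where one difference takes \<open>u k\<close> to
  \<open>u k - u (Suc k)\<close>.\<close>

lemma alt_binomial_sum_Suc:
  "alt_binomial_sum (Suc n) u = alt_binomial_sum n u - alt_binomial_sum n (\<lambda>k. u (Suc k))"
proof -
  have "alt_binomial_sum (Suc n) u = u 0 + (\<Sum>k=0..n. real (Suc n choose Suc k) * (- 1) ^ Suc k * u (Suc k))"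
    unfolding alt_binomial_sum_def by (subst sum.atLeast0_atMost_Suc_shift) simp
  also have "\<dots> = (u 0 + (\<Sum>k=0..n. real (n choose Suc k) * (- 1) ^ Suc k * u (Suc k)))
      - alt_binomial_sum n (\<lambda>k. u (Suc k))"
  proof -
    have "(\<Sum>k=0..n. real (Suc n choose Suc k) * (- 1) ^ Suc k * u (Suc k)) =
        (\<Sum>k=0..n. real (n choose Suc k) * (- 1) ^ Suc k * u (Suc k))
        - alt_binomial_sum n (\<lambda>k. u (Suc k))"
      unfolding alt_binomial_sum_def sum_subtractf[symmetric]
      by (intro sum.cong) (auto simp: algebra_simps)
    then show ?thesis by simp
  qed
  also have "u 0 + (\<Sum>k=0..n. real (n choose Suc k) * (- 1) ^ Suc k * u (Suc k))
      = (\<Sum>k=0..Suc n. real (n choose k) * (- 1) ^ k * u k)"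
    unfolding sum.atLeast0_atMost_Suc_shift by simp
  also have "\<dots> = alt_binomial_sum n u"
    by (simp add: alt_binomial_sum_def)
  finally show ?thesis .
qed

lemma alt_binomial_sum_diff:
  "alt_binomial_sum n (\<lambda>k. u k - v k) = alt_binomial_sum n u - alt_binomial_sum n v"
  by (simp add: alt_binomial_sum_def algebra_simps sum_subtractf)

lemma alt_binomial_sum_mult:
  "alt_binomial_sum n (\<lambda>k. c * u k) = c * alt_binomial_sum n u"
  by (simp add: alt_binomial_sum_def algebra_simps sum_distrib_left)

lemma alt_binomial_sum_inversion:
  "alt_binomial_sum n (\<lambda>k. alt_binomial_sum k u) = u n"
proof (induction n arbitrary: u)
  case 0
  show ?case by (simp add: alt_binomial_sum_def)
next
  case (Suc n)
  show ?case
    \<comment> \<open>Expanding the outer and the inner sum leaves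
      \<open>u n - (u n - u (Suc n))\<close>, once the induction hypothesis is used for
      \<open>u\<close> and for its shift.\<close>
    by (simp add: alt_binomial_sum_Suc alt_binomial_sum_diff Suc.IH)
qed


section \<open>Alternating power sums and Newton's identity\<close>

definition alt_power_sum :: "real \<Rightarrow> nat \<Rightarrow> nat \<Rightarrow> real" where
  "alt_power_sum x a n = alt_binomial_sum n (\<lambda>k. 1 / (real k + x + 1) ^ a)"

lemma has_integral_log_beta:
  fixes x :: real
  assumes "x \<ge> 0"
  shows "((\<lambda>t. (1 - t) ^ n * ln t ^ m * t powr x) has_integral
    (- 1) ^ m * fact m * alt_power_sum x (Suc m) n) {0..1}"
proof -
  have "((\<lambda>t. \<Sum>k=0..n. real (n choose k) * (- 1) ^ k * (t powr (real k + x) * ln t ^ m)) has_integral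
      (\<Sum>k=0..n. real (n choose k) * (- 1) ^ k * ((- 1) ^ m * fact m / (real k + x + 1) ^ (m + 1)))) {0..1}"
    using assms by (intro has_integral_sum has_integral_mult_right has_integral_powr_mult_ln_power) auto
  also have "(\<Sum>k=0..n. real (n choose k) * (- 1) ^ k * ((- 1) ^ m * fact m / (real k + x + 1) ^ (m + 1)))
      = (- 1) ^ m * fact m * alt_power_sum x (Suc m) n"
    by (simp add: alt_power_sum_def alt_binomial_sum_def sum_distrib_left mult_ac)
  finally show ?thesis
  \<comment> \<open>Merging \<open>t ^ k\<close> with \<open>t powr x\<close> needs
    \<open>t > 0\<close>, so the integrands are compared away from the null set
    \<open>{0}\<close>.\<close>
  proof (rule has_integral_spike[of "{0}", rotated -1])
    fix t :: real assume t: "t \<in> {0..1} - {0}"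
    have "(1 - t) ^ n = (\<Sum>k=0..n. real (n choose k) * (- 1) ^ k * t ^ k)"
      using binomial_ring[of "- t" 1 n]
      by (simp add: atLeast0AtMost power_minus[of t] mult_ac)
    then show "(1 - t) ^ n * ln t ^ m * t powr x =
        (\<Sum>k=0..n. real (n choose k) * (- 1) ^ k * (t powr (real k + x) * ln t ^ m))"
      using t by (simp add: sum_distrib_right sum_distrib_left powr_add powr_realpow mult_ac)
  qed auto
qed

lemma alt_power_sum_at_0 [simp]: "alt_power_sum x a 0 = 1 / (x + 1) ^ a"
  by (simp add: alt_power_sum_def alt_binomial_sum_def)

lemma alt_power_sum_exponent_0 [simp]: "alt_power_sum x 0 (Suc n) = 0"
  by (simp add: alt_power_sum_def alt_binomial_sum_Suc)

text \<open>Split the factor as \<open>n + x + 2 = (k + x + 1) + (n + 1 - k)\<close> in each term: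
  the first part lowers the exponent, the second is absorbed into the binomial coefficient.\<close>

lemma alt_power_sum_rec:
  fixes x :: real
  assumes "x \<ge> 0"
  shows "(real n + x + 2) * alt_power_sum x (Suc a) (Suc n) =
    alt_power_sum x a (Suc n) + (real n + 1) * alt_power_sum x (Suc a) n"
proof -
  let ?d = "\<lambda>k. real k + x + 1"
  have "(real n + x + 2) * (real (Suc n choose k) * (- 1) ^ k * (1 / ?d k ^ Suc a))
      = real (Suc n choose k) * (- 1) ^ k * (1 / ?d k ^ a)
        + (real n + 1) * (real (n choose k) * (- 1) ^ k * (1 / ?d k ^ Suc a))"
    if "k \<le> Suc n" for k
  proof -
    have "(Suc n - k) * (Suc n choose k) = Suc n * (n choose k)"
      by (cases "k = Suc n") (use that binomial_absorb_comp[of "Suc n" k] in auto)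
    then have "real (Suc n - k) * real (Suc n choose k) = real (Suc n) * real (n choose k)"
      by (simp only: flip: of_nat_mult)
    then have "(real n + x + 2) * real (Suc n choose k) =
        ?d k * real (Suc n choose k) + (real n + 1) * real (n choose k)"
      using that by (simp add: of_nat_diff algebra_simps)
    then have "(real n + x + 2) * (real (Suc n choose k) * (- 1) ^ k * (1 / ?d k ^ Suc a))
        = (?d k * real (Suc n choose k) + (real n + 1) * real (n choose k)) * (- 1) ^ k * (1 / ?d k ^ Suc a)"
      by (simp only: mult.assoc[symmetric])
    also have "\<dots> = real (Suc n choose k) * (- 1) ^ k * (?d k / ?d k ^ Suc a)
        + (real n + 1) * (real (n choose k) * (- 1) ^ k * (1 / ?d k ^ Suc a))"
    proof -
      have "(d * B + c * b) * s * (1 / e) = B * s * (d / e) + c * (b * s * (1 / e))"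
        for d B c b s e :: real
        by (simp add: algebra_simps add_divide_distrib)
      then show ?thesis .
    qed
    also have "?d k / ?d k ^ Suc a = 1 / ?d k ^ a"
      using assms by simp
    finally show ?thesis .
  qed
  then have "(real n + x + 2) * alt_power_sum x (Suc a) (Suc n) = alt_power_sum x a (Suc n) +
     (real n + 1) * (\<Sum>k=0..Suc n. real (n choose k) * (- 1) ^ k * (1 / ?d k ^ Suc a))"
    unfolding alt_power_sum_def alt_binomial_sum_def sum_distrib_left sum.distrib[symmetric]
    by (intro sum.cong) auto
  \<comment> \<open>The last sum runs one term too far, but \<open>n choose Suc n\<close> is
    0.\<close>
  then show ?thesis by (simp add: alt_power_sum_def alt_binomial_sum_def)
qed

text \<open>Induction on \<open>n\<close>, and within each step on \<open>r\<close>. Passing to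
  \<open>Suc n\<close> adjoins the variable \<open>A\<close>: \<open>p\<close> adds its power to the
  power sums, and \<open>rec\<close> is the recurrence of complete homogeneous polynomials, with
  \<open>C\<close> accounting for the change of the normalising factor.\<close>

lemma alt_power_sum_newton:
  fixes x :: real
  assumes "x \<ge> 0"
  shows "(\<Sum>l\<le>r. shifted_harm n x (Suc l) * alt_power_sum x (Suc r - l) n) =
    real (Suc r) * alt_power_sum x (Suc (Suc r)) n"
proof (induction n arbitrary: r)
  case 0
  have "(\<Sum>l\<le>r. shifted_harm 0 x (Suc l) * alt_power_sum x (Suc r - l) 0) =
      (\<Sum>l\<le>r. 1 / (x + 1) ^ Suc (Suc r))"
    by (intro sum.cong) (auto simp: shifted_harm_def simp flip: power_Suc power_add)
  then show ?case by simp
next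
  case (Suc n)
  note IH_n = Suc.IH
  define A where "A = 1 / (real n + x + 2)"
  define C where "C = (real n + 1) * A"
  let ?S = "alt_power_sum x" and ?p = "shifted_harm"
  have rec: "?S (Suc a) (Suc n) = A * ?S a (Suc n) + C * ?S (Suc a) n" for a
  proof -
    have "?S (Suc a) (Suc n) = (?S a (Suc n) + (real n + 1) * ?S (Suc a) n) / (real n + x + 2)"
      unfolding alt_power_sum_rec[OF assms, symmetric] using assms by simp
    then show ?thesis by (simp only: A_def C_def add_divide_distrib) simp
  qed
  have p: "?p (Suc n) x b = ?p n x b + A ^ b" for b
    by (simp add: shifted_harm_def A_def power_one_over add_ac)
  \<comment> \<open>Iterating \<open>rec\<close> stops at exponent 0, where
    \<open>?S 0 (Suc n) = 0\<close>.\<close>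
  have unfolded: "?S (Suc r) (Suc n) = C * (\<Sum>l\<le>r. A ^ l * ?S (Suc r - l) n)" for r
  proof (induction r)
    case 0
    then show ?case by (simp add: rec)
  next
    case (Suc r)
    show ?case
      unfolding sum.atMost_Suc_shift rec[of "Suc r"] Suc.IH
      by (simp add: algebra_simps sum_distrib_left)
  qed
  show ?case
  proof (induction r)
    case 0
    then show ?case using IH_n[of 0] unfolded[of 0]
      by (simp add: rec p algebra_simps)
  next
    case (Suc r)
    have "(\<Sum>l\<le>Suc r. ?p (Suc n) x (Suc l) * ?S (Suc (Suc r) - l) (Suc n)) =
        (\<Sum>l\<le>Suc r. A * (?p (Suc n) x (Suc l) * ?S (Suc r - l) (Suc n))
          + C * (?p n x (Suc l) * ?S (Suc (Suc r) - l) n)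
          + A * (C * (A ^ l * ?S (Suc (Suc r) - l) n)))"
    proof (intro sum.cong refl)
      fix l assume "l \<in> {..Suc r}"
      then have "Suc (Suc r) - l = Suc (Suc r - l)" by auto
      then show "?p (Suc n) x (Suc l) * ?S (Suc (Suc r) - l) (Suc n) =
        A * (?p (Suc n) x (Suc l) * ?S (Suc r - l) (Suc n))
          + C * (?p n x (Suc l) * ?S (Suc (Suc r) - l) n)
          + A * (C * (A ^ l * ?S (Suc (Suc r) - l) n))"
        by (simp only: rec) (simp add: p algebra_simps)
    qed
    \<comment> \<open>The term \<open>l = Suc r\<close> of the first sum has exponent 0 and
      vanishes. The three sums are then given by the hypothesis for \<open>r\<close>, the hypothesis
      for \<open>n\<close>, and \<open>unfolded\<close>.\<close>
    also have "\<dots> = A * (\<Sum>l\<le>r. ?p (Suc n) x (Suc l) * ?S (Suc r - l) (Suc n))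
        + C * (\<Sum>l\<le>Suc r. ?p n x (Suc l) * ?S (Suc (Suc r) - l) n)
        + A * (C * (\<Sum>l\<le>Suc r. A ^ l * ?S (Suc (Suc r) - l) n))"
      unfolding sum.distrib sum_distrib_left[symmetric] by simp
    also have "\<dots> = A * (real (Suc r) * ?S (Suc (Suc r)) (Suc n))
        + C * (real (Suc (Suc r)) * ?S (Suc (Suc (Suc r))) n) + A * ?S (Suc (Suc r)) (Suc n)"
      using Suc.IH IH_n[of "Suc r"] unfolded[of "Suc r"] by (simp only:)
    also have "\<dots> = real (Suc (Suc r)) * ?S (Suc (Suc (Suc r))) (Suc n)"
      by (subst (2) rec) (simp add: algebra_simps)
    finally show ?case .
  qed
qed

text \<open>The common source of all three identities: the factorials of the integrals combine with
  \<open>(r choose l) * fact l\<close> to \<open>fact r\<close>, so that Newton's identity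
  applies.\<close>

lemma log_beta_sum_eq:
  fixes x :: real
  assumes "x \<ge> 0"
  shows "(\<Sum>l=0..r. real (r choose l) * fact l * (- 1) ^ l * shifted_harm n x (l + 1) *
      integral {0..1} (\<lambda>t. (1 - t) ^ n * ln t ^ (r - l) * t powr x)) =
    (- 1) ^ r * fact (r + 1) * alt_power_sum x (r + 2) n"
proof -
  have "real (r choose l) * fact l * (- 1) ^ l * shifted_harm n x (l + 1) *
      integral {0..1} (\<lambda>t. (1 - t) ^ n * ln t ^ (r - l) * t powr x) =
    (- 1) ^ r * fact r * (shifted_harm n x (Suc l) * alt_power_sum x (Suc r - l) n)"
    if "l \<le> r" for l
  proof -
    have "integral {0..1} (\<lambda>t. (1 - t) ^ n * ln t ^ (r - l) * t powr x) =
        (- 1) ^ (r - l) * fact (r - l) * alt_power_sum x (Suc r - l) n"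
      using has_integral_log_beta[OF assms, THEN integral_unique] that by (simp add: Suc_diff_le)
    moreover have "real (r choose l) * fact l * fact (r - l) = fact r"
      using binomial_fact_lemma[OF that, THEN arg_cong[where f = real]]
      by (simp add: mult_ac)
    moreover have "(- 1 :: real) ^ l * (- 1) ^ (r - l) = (- 1) ^ r"
      using that by (simp flip: power_add)
    moreover have "c * f * s * h * (s' * f' * S) = (s * s') * (c * f * f') * (h * S)"
      for c f s h s' f' S :: real
      by (simp add: mult_ac)
    ultimately show ?thesis by (simp only: Suc_eq_plus1)
  qed
  then have "(\<Sum>l=0..r. real (r choose l) * fact l * (- 1) ^ l * shifted_harm n x (l + 1) *
      integral {0..1} (\<lambda>t. (1 - t) ^ n * ln t ^ (r - l) * t powr x)) =
    (- 1) ^ r * fact r * (\<Sum>l\<le>r. shifted_harm n x (Suc l) * alt_power_sum x (Suc r - l) n)"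
    unfolding sum_distrib_left by (intro sum.cong) auto
  then show ?thesis
    by (simp add: alt_power_sum_newton[OF assms] mult_ac)
qed

section \<open>The telescoping series at \<open>x = 0\<close>\<close>

lemma alt_power_sum_nonneg:
  fixes x :: real
  assumes "x \<ge> 0"
  shows "alt_power_sum x a n \<ge> 0"
proof (induction n arbitrary: a)
  case 0
  then show ?case using assms by simp
next
  case (Suc n)
  note IH_n = Suc.IH
  show ?case
  proof (induction a)
    case (Suc a)
    \<comment> \<open>The defining sum alternates in sign, whereas the recurrence has only
      nonnegative terms on its right.\<close>
    have "0 \<le> (real n + x + 2) * alt_power_sum x (Suc a) (Suc n)"
      unfolding alt_power_sum_rec[OF assms] using Suc.IH IH_n[of "Suc a"] by simp
    then show ?case using assms by (simp add: zero_le_mult_iff)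
  qed simp
qed

text \<open>Write \<open>S\<^sub>a(n)\<close> for \<open>alt_power_sum 0 a n\<close>. At \<open>x = 0\<close> the recurrence reads
  \<open>S\<^sub>a\<^sub>+\<^sub>1(n) / n = S\<^sub>a(n) / n + S\<^sub>a\<^sub>+\<^sub>1(n - 1) - S\<^sub>a\<^sub>+\<^sub>1(n)\<close>, so the series telescope. The limit of
  \<open>S\<^sub>a\<^sub>+\<^sub>1\<close> must vanish, since otherwise the sum would dominate the harmonic series.\<close>

lemma alt_power_sum_div_sums:
  "(\<lambda>n. alt_power_sum 0 (Suc a) (Suc n) / real (Suc n)) sums real (Suc a)"
proof (induction a)
  let ?S = "alt_power_sum 0"
  have step: "?S (Suc a) (Suc n) / real (Suc n) =
      ?S a (Suc n) / real (Suc n) + (?S (Suc a) n - ?S (Suc a) (Suc n))" for a n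
    using alt_power_sum_rec[of 0 n a] by (simp add: field_simps)
  have main: "(\<lambda>n. ?S (Suc a) (Suc n) / real (Suc n)) sums (s + 1)"
    if IH: "(\<lambda>n. ?S a (Suc n) / real (Suc n)) sums s" for a s
  proof -
    \<comment> \<open>The 1 is \<open>?S (Suc a) 0\<close>, the starting value of the
      telescope.\<close>
    have partial: "(\<Sum>n<N. ?S (Suc a) (Suc n) / real (Suc n)) =
        (\<Sum>n<N. ?S a (Suc n) / real (Suc n)) + (1 - ?S (Suc a) N)" for N
      by (simp only: step sum.distrib sum_lessThan_telescope') simp
    have summ: "summable (\<lambda>n. ?S (Suc a) (Suc n) / real (Suc n))"
    proof (rule summableI_nonneg_bounded)
      fix N
      have "(\<Sum>n<N. ?S a (Suc n) / real (Suc n)) \<le> s"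
        unfolding sums_unique[OF IH]
        by (intro sum_le_suminf sums_summable[OF IH]) (auto simp: alt_power_sum_nonneg)
      then show "(\<Sum>n<N. ?S (Suc a) (Suc n) / real (Suc n)) \<le> s + 1"
        unfolding partial using alt_power_sum_nonneg[of 0 "Suc a" N] by simp
    qed (simp add: alt_power_sum_nonneg)
    define L where "L = s + 1 - (\<Sum>n. ?S (Suc a) (Suc n) / real (Suc n))"
    have "(\<lambda>N. (\<Sum>n<N. ?S a (Suc n) / real (Suc n)) + 1 -
        (\<Sum>n<N. ?S (Suc a) (Suc n) / real (Suc n))) \<longlonglongrightarrow> L"
      unfolding L_def using IH summable_LIMSEQ[OF summ]
      by (intro tendsto_intros) (auto simp: sums_def)
    then have lim: "?S (Suc a) \<longlonglongrightarrow> L"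
      unfolding partial by simp
    have "L \<ge> 0"
      using lim by (rule LIMSEQ_le_const) (auto simp: alt_power_sum_nonneg)
    moreover have "\<not> L > 0"
    proof
      assume "L > 0"
      then have "eventually (\<lambda>n. L / 2 < ?S (Suc a) (Suc n)) sequentially"
        using order_tendstoD(1)[OF LIMSEQ_Suc[OF lim], of "L / 2"] by simp
      then have "eventually (\<lambda>n. norm (inverse (real (Suc n))) \<le>
          2 / L * (?S (Suc a) (Suc n) / real (Suc n))) sequentially"
        by eventually_elim (use \<open>L > 0\<close> in \<open>simp add: divide_simps\<close>)
      then have "summable (\<lambda>n. inverse (real (Suc n)))"
        by (rule summable_comparison_test_ev) (intro summable_mult summ)
      then show False
        using not_summable_harmonic[where 'a = real]
        by (subst (asm) summable_Suc_iff[of "\<lambda>n. inverse (real n)"]) simp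
    qed
    ultimately have "L = 0" by simp
    then show ?thesis using summ by (simp add: L_def sums_iff)
  qed
  {
    case 0
    \<comment> \<open>For exponent 0 every term is 0, so the recursion starts from sum 0.\<close>
    show ?case using main[of 0 0] by simp
  next
    case (Suc a)
    show ?case using main[OF Suc.IH] by (simp add: add_ac)
  }
qed

section \<open>Passing between the notions of the statement\<close>

lemma gen_harm_eq_shifted_harm: "gen_harm (n + 1) a = shifted_harm n 0 a"
  unfolding gen_harm_def shifted_harm_def
  by (simp add: sum.atLeast_Suc_atMost_Suc_shift add_ac del: sum.cl_ivl_Suc)

text \<open>Makes the case \<open>x = 0\<close> applicable to the third identity:
  \<open>t powr 0\<close> is 1 except at \<open>t = 0\<close>, where it is 0.\<close>

lemma integral_log_beta_at_0:
  "integral {0..1} (\<lambda>t. (1 - t) ^ n * ln t ^ m) =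
    integral {0..1} (\<lambda>t::real. (1 - t) ^ n * ln t ^ m * t powr 0)"
  by (rule integral_spike[of "{0}"]) auto

lemma hurwitz_zeta_of_nat:
  fixes y :: real
  assumes "y > 0"
  shows "hurwitz_zeta y (of_nat a) = (\<Sum>n. complex_of_real (1 / (real n + y) ^ a))"
proof -
  have "complex_of_real (real n + y) powr of_nat a = complex_of_real (real n + y) ^ a" for n
  proof (rule powr_nat')
    show "complex_of_real (real n + y) \<noteq> 0 \<or> a \<noteq> 0"
      using assms unfolding of_real_eq_0_iff by linarith
  qed
  then show ?thesis by (simp add: hurwitz_zeta_def)
qed

lemma summable_inverse_power_shift:
  fixes y :: real
  assumes "y > 0" and "a \<ge> 2"
  shows "summable (\<lambda>n. 1 / (real n + y) ^ a)"
proof (rule summable_comparison_test_ev)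
  show "summable (\<lambda>n. inverse (real n ^ a))"
    using assms(2) by (rule inverse_power_summable)
  show "\<forall>\<^sub>F n in sequentially. norm (1 / (real n + y) ^ a) \<le> inverse (real n ^ a)"
    \<comment> \<open>At \<open>n = 0\<close> the bound fails, because it is
      \<open>inverse 0 = 0\<close>.\<close>
    using eventually_gt_at_top[of 0]
    by eventually_elim (use assms in \<open>auto simp: divide_simps intro!: power_mono\<close>)
qed

section \<open>The three identities\<close>

theorem theorem2p6:
  fixes n r :: nat and x :: real
  assumes "x \<ge> 0"
  shows
    "(\<Sum>k=0..n. real (n choose k) * (- 1) ^ k * (1 / (real k + x + 1) ^ (r + 2))) =
       (- 1) ^ r / fact (r + 1) *
       (\<Sum>l=0..r. real (r choose l) * fact l * (- 1) ^ l * shifted_harm n x (l + 1) *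
          integral {0..1} (\<lambda>t. (1 - t) ^ n * ln t ^ (r - l) * t powr x))
     \<and>
     (let f = (\<lambda>n. \<Sum>k=0..n. real (n choose k) * (- 1) ^ k *
                (\<Sum>l=0..r. real (r choose l) * fact l * (- 1) ^ l * shifted_harm k x (l + 1) *
                   integral {0..1} (\<lambda>t. (1 - t) ^ k * ln t ^ (r - l) * t powr x)))
      in summable f \<and>
         complex_of_real ((- 1) ^ r / fact (r + 1) * (\<Sum>n. f n)) =
           hurwitz_zeta (x + 1) (of_nat (r + 2)))
     \<and>
     (let g = (\<lambda>l n. 1 / real n * gen_harm (n + 1) (l + 1) *
                integral {0..1} (\<lambda>t. (1 - t) ^ n * ln t ^ (r - l)))
      in (\<forall>l\<le>r. summable (\<lambda>n. g l (Suc n))) \<and>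
         (\<Sum>l=0..r. real (r choose l) * fact l * (- 1) ^ l * (\<Sum>n. g l (Suc n))) =
           (- 1) ^ r * fact (r + 2))"
proof (intro conjI)
  let ?G = "\<lambda>n. \<Sum>l=0..r. real (r choose l) * fact l * (- 1) ^ l * shifted_harm n x (l + 1) *
    integral {0..1} (\<lambda>t. (1 - t) ^ n * ln t ^ (r - l) * t powr x)"
  have sq: "(- 1 :: real) ^ r * (- 1) ^ r = 1"
    by (simp flip: power_mult_distrib)
  show "(\<Sum>k=0..n. real (n choose k) * (- 1) ^ k * (1 / (real k + x + 1) ^ (r + 2))) =
      (- 1) ^ r / fact (r + 1) * ?G n"
    unfolding log_beta_sum_eq[OF assms] using sq
    by (simp add: alt_power_sum_def alt_binomial_sum_def mult.assoc[symmetric] del: fact_Suc)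
  define c :: real where "c = (- 1) ^ r * fact (r + 1)"
  \<comment> \<open>By the first identity \<open>?G k\<close> is \<open>c\<close> times an
    alternating binomial sum, which the outer sum inverts.\<close>
  have f: "(\<lambda>n. \<Sum>k=0..n. real (n choose k) * (- 1) ^ k * ?G k) =
      (\<lambda>n. c * (1 / (real n + (x + 1)) ^ (r + 2)))"
  proof
    fix n
    have "(\<Sum>k=0..n. real (n choose k) * (- 1) ^ k * ?G k) =
        alt_binomial_sum n (\<lambda>k. c * alt_power_sum x (r + 2) k)"
      unfolding log_beta_sum_eq[OF assms] by (simp only: alt_binomial_sum_def c_def)
    also have "\<dots> = c * (1 / (real n + (x + 1)) ^ (r + 2))"
      unfolding alt_binomial_sum_mult alt_power_sum_def alt_binomial_sum_inversion
      by (simp only: add.assoc)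
    finally show "(\<Sum>k=0..n. real (n choose k) * (- 1) ^ k * ?G k) =
        c * (1 / (real n + (x + 1)) ^ (r + 2))" .
  qed
  have summ: "summable (\<lambda>n. 1 / (real n + (x + 1)) ^ (r + 2))"
    using assms by (intro summable_inverse_power_shift) auto
  have "(- 1) ^ r / fact (r + 1) * (\<Sum>n. c * (1 / (real n + (x + 1)) ^ (r + 2))) =
      (\<Sum>n. 1 / (real n + (x + 1)) ^ (r + 2))"
    unfolding suminf_mult[OF summ] c_def using sq
    by (simp add: mult.assoc[symmetric] del: fact_Suc)
  then have "complex_of_real ((- 1) ^ r / fact (r + 1) *
      (\<Sum>n. c * (1 / (real n + (x + 1)) ^ (r + 2)))) = hurwitz_zeta (x + 1) (of_nat (r + 2))"
    using assms hurwitz_zeta_of_nat[of "x + 1" "r + 2"] suminf_of_real[OF summ, where 'a = complex]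
    by simp
  then show "let f = (\<lambda>n. \<Sum>k=0..n. real (n choose k) * (- 1) ^ k * ?G k)
      in summable f \<and>
         complex_of_real ((- 1) ^ r / fact (r + 1) * (\<Sum>n. f n)) =
           hurwitz_zeta (x + 1) (of_nat (r + 2))"
    unfolding Let_def f using summable_mult[OF summ] by blast
  let ?g = "\<lambda>l n. 1 / real n * gen_harm (n + 1) (l + 1) *
                integral {0..1} (\<lambda>t. (1 - t) ^ n * ln t ^ (r - l))"
  let ?S = "alt_power_sum 0"
  \<comment> \<open>Up to a constant, the product in \<open>?g l n\<close> is a single term of
    Newton's identity. All terms there are nonnegative, so each is at most the total, whose quotient
    by \<open>n\<close> is summable.\<close>
  have summ_g: "summable (\<lambda>n. ?g l (Suc n))" if "l \<le> r" for l
  proof -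
    let ?h = "\<lambda>n. shifted_harm n 0 (Suc l) * ?S (Suc r - l) n"
    have harm: "shifted_harm n 0 a \<ge> 0" for n a
      by (simp add: shifted_harm_def sum_nonneg)
    have le: "?h n \<le> real (Suc r) * ?S (Suc (Suc r)) n" for n
      unfolding alt_power_sum_newton[OF order_refl, symmetric] using that
      by (intro member_le_sum[where f = "\<lambda>l. shifted_harm n 0 (Suc l) * ?S (Suc r - l) n"])
         (auto intro!: mult_nonneg_nonneg harm alt_power_sum_nonneg)
    have "summable (\<lambda>n. ?h (Suc n) / real (Suc n))"
    proof (rule summable_comparison_test')
      show "summable (\<lambda>n. real (Suc r) * (?S (Suc (Suc r)) (Suc n) / real (Suc n)))"
        by (intro summable_mult sums_summable[OF alt_power_sum_div_sums])
      show "norm (?h (Suc n) / real (Suc n)) \<le> real (Suc r) * (?S (Suc (Suc r)) (Suc n) / real (Suc n))" for n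
      proof -
        have "0 \<le> ?h (Suc n)" by (intro mult_nonneg_nonneg harm alt_power_sum_nonneg) auto
        then show ?thesis using divide_right_mono[OF le[of "Suc n"], of "real (Suc n)"] by simp
      qed
    qed
    from summable_mult[OF this, of "(- 1) ^ (r - l) * fact (r - l)"] show ?thesis
      unfolding integral_log_beta_at_0 gen_harm_eq_shifted_harm
        has_integral_log_beta[OF order_refl, THEN integral_unique]
      using that by (simp add: Suc_diff_le mult_ac)
  qed
  have "(\<Sum>l=0..r. real (r choose l) * fact l * (- 1) ^ l * (\<Sum>n. ?g l (Suc n))) =
      (\<Sum>n. \<Sum>l=0..r. real (r choose l) * fact l * (- 1) ^ l * ?g l (Suc n))"
  proof -
    have "(\<Sum>n. \<Sum>l=0..r. real (r choose l) * fact l * (- 1) ^ l * ?g l (Suc n)) =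
        (\<Sum>l=0..r. \<Sum>n. real (r choose l) * fact l * (- 1) ^ l * ?g l (Suc n))"
      by (rule suminf_sum) (intro summable_mult summ_g, simp)
    also have "\<dots> = (\<Sum>l=0..r. real (r choose l) * fact l * (- 1) ^ l * (\<Sum>n. ?g l (Suc n)))"
      by (intro sum.cong refl suminf_mult summ_g) simp
    finally show ?thesis by (rule sym)
  qed
  \<comment> \<open>After the exchange of the sums, the inner sum is the first identity at
    \<open>x = 0\<close> and index \<open>Suc n\<close>.\<close>
  also have "(\<lambda>n. \<Sum>l=0..r. real (r choose l) * fact l * (- 1) ^ l * ?g l (Suc n)) =
      (\<lambda>n. c * (?S (Suc (Suc r)) (Suc n) / real (Suc n)))"
  proof
    fix n
    have "(\<Sum>l=0..r. real (r choose l) * fact l * (- 1) ^ l * ?g l (Suc n)) =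
      (\<Sum>l=0..r. real (r choose l) * fact l * (- 1) ^ l * shifted_harm (Suc n) 0 (l + 1) *
        integral {0..1} (\<lambda>t. (1 - t) ^ Suc n * ln t ^ (r - l) * t powr 0)) / real (Suc n)"
      unfolding sum_divide_distrib integral_log_beta_at_0 gen_harm_eq_shifted_harm
      by (intro sum.cong) auto
    then show "(\<Sum>l=0..r. real (r choose l) * fact l * (- 1) ^ l * ?g l (Suc n)) =
        c * (?S (Suc (Suc r)) (Suc n) / real (Suc n))"
      unfolding log_beta_sum_eq[OF order_refl] c_def by simp
  qed
  also have "(\<Sum>n. c * (?S (Suc (Suc r)) (Suc n) / real (Suc n))) = c * real (Suc (Suc r))"
    using sums_mult[OF alt_power_sum_div_sums, THEN sums_unique] by metis
  also have "\<dots> = (- 1) ^ r * fact (r + 2)"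
    by (simp add: c_def algebra_simps)
  finally show "let g = ?g
      in (\<forall>l\<le>r. summable (\<lambda>n. g l (Suc n))) \<and>
         (\<Sum>l=0..r. real (r choose l) * fact l * (- 1) ^ l * (\<Sum>n. g l (Suc n))) =
           (- 1) ^ r * fact (r + 2)"
    unfolding Let_def using summ_g by blast
qed

end
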